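(* Let $\mathcal{S}=\langle\mathcal{L},\vdash\rangle$ be a monotonic logic with $\mathcal{L}$ infinite. If $\mathcal{S}$ is finitely trivializable, then sECQ holds in $\mathcal{S}$.
   Context: A logic is a pair $\langle\mathcal{L},\vdash\rangle$ with $\mathcal{L}$ a set and $\vdash\,\subseteq\mathcal{P}(\mathcal{L})\times\mathcal{L}$; $C_\vdash(\Gamma)=\{\alpha:\Gamma\vdash\alpha\}$. Monotonic: $\Gamma\subseteq\Sigma$ implies $C_\vdash(\Gamma)\subseteq C_\vdash(\Sigma)$. $\mathcal{S}$ is finitely trivializable if there is a finite $\Gamma\subseteq\mathcal{L}$ with $C_\vdash(\Gamma)=\mathcal{L}$. sECQ: for each $\alpha\in\mathcal{L}$ there is $\Gamma\subsetneq\mathcal{L}$ with $\alpha\in\Gamma$ and $C_\vdash(\Gamma)=\mathcal{L}$. *)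

theory Defs
  imports Main
begin

text \<open>A logic is given by its carrier \<open>L\<close> and its consequence relation \<open>V\<close>, a set of
  pairs of a set of formulas and a formula. No structure on formulas is assumed.\<close>

definition is_logic :: "'a set \<Rightarrow> ('a set \<times> 'a) set \<Rightarrow> bool" where
  "is_logic L V \<longleftrightarrow> V \<subseteq> Pow L \<times> L"

definition Cn :: "('a set \<times> 'a) set \<Rightarrow> 'a set \<Rightarrow> 'a set" where
  "Cn V \<Gamma> = {\<alpha>. (\<Gamma>, \<alpha>) \<in> V}"

definition monotonic :: "'a set \<Rightarrow> ('a set \<times> 'a) set \<Rightarrow> bool" where
  "monotonic L V \<longleftrightarrow> (\<forall>\<Gamma> \<Sigma>. \<Gamma> \<subseteq> L \<longrightarrow> \<Sigma> \<subseteq> L \<longrightarrow> \<Gamma> \<subseteq> \<Sigma> \<longrightarrow> Cn V \<Gamma> \<subseteq> Cn V \<Sigma>)"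

definition finitely_trivializable :: "'a set \<Rightarrow> ('a set \<times> 'a) set \<Rightarrow> bool" where
  "finitely_trivializable L V \<longleftrightarrow> (\<exists>\<Gamma>. \<Gamma> \<subseteq> L \<and> finite \<Gamma> \<and> Cn V \<Gamma> = L)"

definition sECQ :: "'a set \<Rightarrow> ('a set \<times> 'a) set \<Rightarrow> bool" where
  "sECQ L V \<longleftrightarrow> (\<forall>\<alpha>\<in>L. \<exists>\<Gamma>. \<Gamma> \<subset> L \<and> \<alpha> \<in> \<Gamma> \<and> Cn V \<Gamma> = L)"

end

theory Submission
  imports Defs
begin

text \<open>Adjoining one formula \<alpha> to a finite trivializing set \<Gamma> gives a witness for
  \<alpha>: by monotonicity it still trivializes, and being finite it cannot exhaust the infinite
  \<open>L\<close>.\<close>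

theorem theorem3p29:
  fixes L :: "'a set" and V :: "('a set \<times> 'a) set"
  assumes "is_logic L V"
    and "monotonic L V"
    and "infinite L"
    and "finitely_trivializable L V"
  shows "sECQ L V"
  unfolding sECQ_def
proof
  fix \<alpha> assume "\<alpha> \<in> L"
  obtain \<Gamma> where \<Gamma>: "\<Gamma> \<subseteq> L" "finite \<Gamma>" "Cn V \<Gamma> = L"
    using assms(4) unfolding finitely_trivializable_def by blast
  have sub: "insert \<alpha> \<Gamma> \<subseteq> L"
    using \<Gamma>(1) \<open>\<alpha> \<in> L\<close> by blast
  \<comment> \<open>Properness is a matter of cardinality alone: equality would make
    \<open>L\<close> finite.\<close>
  moreover have "insert \<alpha> \<Gamma> \<noteq> L"
    using \<Gamma>(2) assms(3) by (metis finite_insert)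
  moreover have "L \<subseteq> Cn V (insert \<alpha> \<Gamma>)"
    using assms(2) \<Gamma>(1,3) sub unfolding monotonic_def by (metis subset_insertI)
  \<comment> \<open>Monotonicity bounds the consequences only from below; the upper bound comes from
    \<open>V\<close> relating sets to members of \<open>L\<close> only.\<close>
  moreover have "Cn V (insert \<alpha> \<Gamma>) \<subseteq> L"
    using assms(1) unfolding is_logic_def Cn_def by blast
  ultimately show "\<exists>\<Gamma>. \<Gamma> \<subset> L \<and> \<alpha> \<in> \<Gamma> \<and> Cn V \<Gamma> = L"
    by (intro exI[of _ "insert \<alpha> \<Gamma>"]) blast
qed

end
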